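(* Let $A$ and $B$ be finite sets, $f:A\to B$ a surjective function, and $P$ a stochastic matrix with rows and columns indexed by $A$. Let $\alpha$ be any stationary probability distribution for $P$ such that $\alpha(x)>0$ for every $x\in A$. Let the time reversal of $\mathrm{MC}(\alpha,P)$ be $\mathrm{MC}(\alpha,P^\star)$. Suppose that $P$ lumps weakly under $f$ with stable space $V$, and $\alpha\in V$. If $V$ is a real vector space, define \[W=\Bigl\{w\in\mathbb{R}^A:\ \sum_{x\in A}\frac{v(x)w(x)}{\alpha(x)}=0\ \text{ for all }v\in V^\circ\Bigr\},\] and if $V$ is a complex vector space, define \[W=\Bigl\{w\in\mathbb{C}^A:\ \sum_{x\in A}\frac{\overline{v(x)}w(x)}{\alpha(x)}=0\ \text{ for all }v\in V^\circ\Bigr\}.\] Then $\alpha\in W$ and $P^\star$ lumps weakly under $f$ with stable space $W$.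
   Context: Stochastic matrices act on the right on row vectors, and $\mathrm{MC}(\alpha,P)$ is the time-homogeneous Markov chain with initial distribution $\alpha$ and transition matrix $P$. $P^\star(x,y)=\frac{\alpha(y)}{\alpha(x)}P(y,x)$. $F$ is the matrix with $F_{a,b}=1$ if $f(a)=b$ and $0$ otherwise, so $(vF)_b=\sum_{a\in f^{-1}(b)}v(a)$. For a subspace $V$ of $\mathbb{R}^A$ (or $\mathbb{C}^A$), $V^\circ=V\cap\ker F=\{v\in V:vF=0\}$. For $b\in B$, $\Pi_b$ is the coordinate projection onto $f^{-1}(b)$: $e_a\Pi_b=e_a$ if $f(a)=b$ and $0$ otherwise. A stochastic matrix $P$ lumps weakly under $f$ with stable space $V$, where $V$ is a real subspace of $\mathbb{R}^A$ or a complex subspace of $\mathbb{C}^A$, if (a) $V$ contains at least one probability vector; (b) $VP\subseteq V$; (c) $V\Pi_b\subseteq V$ for all $b\in B$; (d) $V^\circ PF=0$ (equivalently $V^\circ P\subseteq V^\circ$). *)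

theory Defs
  imports "HOL-Analysis.Analysis"
begin

definition prob_vector :: "real^'a::finite \<Rightarrow> bool" where
  "prob_vector p \<longleftrightarrow> (\<forall>x. 0 \<le> p $ x) \<and> (\<Sum>x\<in>UNIV. p $ x) = 1"

definition stochastic_matrix :: "real^'a^'a::finite \<Rightarrow> bool" where
  "stochastic_matrix P \<longleftrightarrow> (\<forall>x. prob_vector (P $ x))"

definition stationary_distribution :: "real^'a::finite \<Rightarrow> real^'a^'a \<Rightarrow> bool" where
  "stationary_distribution \<alpha> P \<longleftrightarrow> prob_vector \<alpha> \<and> \<alpha> v* P = \<alpha>"

definition time_reversal :: "real^'a::finite \<Rightarrow> real^'a^'a \<Rightarrow> real^'a^'a" where
  "time_reversal \<alpha> P = (\<chi> x y. \<alpha> $ y / \<alpha> $ x * P $ y $ x)"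

text \<open>
  The scalar type \<open>'k\<close> below is \<^typ>\<open>real\<close> or \<^typ>\<open>complex\<close>; real vectors and matrices act on
  \<open>'k\<close>-vectors after their entries are embedded into \<open>'k\<close>.
\<close>

definition of_real_vec :: "real^'a \<Rightarrow> 'k::real_algebra_1^'a" where
  "of_real_vec v = (\<chi> x. of_real (v $ x))"

definition lumping_matrix :: "('a \<Rightarrow> 'b) \<Rightarrow> 'k::zero_neq_one^'b^'a" where
  "lumping_matrix f = (\<chi> a b. if f a = b then 1 else 0)"

definition fibre_projection :: "('a \<Rightarrow> 'b) \<Rightarrow> 'b \<Rightarrow> 'k::zero_neq_one^'a^'a" where
  "fibre_projection f b = (\<chi> a a'. if a = a' \<and> f a = b then 1 else 0)"

definition lumping_kernel ::
  "('a::finite \<Rightarrow> 'b::finite) \<Rightarrow> ('k::real_field^'a) set \<Rightarrow> ('k^'a) set" where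
  "lumping_kernel f V = {v \<in> V. v v* (lumping_matrix f :: 'k^'b^'a) = 0}"

text \<open>The subspace condition is over \<open>'k\<close>: \<^term>\<open>vec.subspace\<close> refers to the scalar action \<open>*s\<close>.\<close>

definition lumps_weakly ::
  "('a::finite \<Rightarrow> 'b::finite) \<Rightarrow> real^'a^'a \<Rightarrow> ('k::real_field^'a) set \<Rightarrow> bool" where
  "lumps_weakly f P V \<longleftrightarrow>
     stochastic_matrix P \<and>
     vec.subspace V \<and>
     (\<exists>p. prob_vector p \<and> of_real_vec p \<in> V) \<and>
     (\<forall>v\<in>V. v v* map_matrix of_real P \<in> V) \<and>
     (\<forall>b. \<forall>v\<in>V. v v* fibre_projection f b \<in> V) \<and>
     (\<forall>v\<in>lumping_kernel f V. v v* map_matrix of_real P v* (lumping_matrix f :: 'k^'b^'a) = 0)"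

definition dual_space_real ::
  "('a::finite \<Rightarrow> 'b::finite) \<Rightarrow> real^'a \<Rightarrow> (real^'a) set \<Rightarrow> (real^'a) set" where
  "dual_space_real f \<alpha> V =
     {w. \<forall>v\<in>lumping_kernel f V. (\<Sum>x\<in>UNIV. v $ x * w $ x / \<alpha> $ x) = 0}"

definition dual_space_complex ::
  "('a::finite \<Rightarrow> 'b::finite) \<Rightarrow> real^'a \<Rightarrow> (complex^'a) set \<Rightarrow> (complex^'a) set" where
  "dual_space_complex f \<alpha> V =
     {w. \<forall>v\<in>lumping_kernel f V.
           (\<Sum>x\<in>UNIV. cnj (v $ x) * w $ x / complex_of_real (\<alpha> $ x)) = 0}"

end

theory Submission
  imports Defs
begin

text \<open>
  Write \<open>\<langle>v, w\<rangle>\<close> for the inner product with weights \<open>1/\<alpha>\<close>, so that the dual space \<open>W\<close> is the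
  orthogonal complement of \<open>V\<degree>\<close>. The theorem follows from three facts about this product.
  \<^item> The time reversal is the adjoint of \<open>P\<close> (\<open>pairing_time_reversal\<close>), and every fibre projection is
    self-adjoint (\<open>pairing_fibre_projection\<close>). As \<open>P\<close> and the projections map \<open>V\<degree>\<close> into itself, their
    adjoints map \<open>W\<close> into itself.
  \<^item> The restriction of \<open>\<alpha>\<close> to the fibre over \<open>b\<close> represents the functional that reads off the \<open>b\<close>-th
    entry of \<open>w F\<close> (\<open>pairing_fibre_restriction\<close>). Hence \<open>w F = 0\<close> means that \<open>w\<close> is orthogonal to all
    these restrictions; the restrictions lie in \<open>V\<close>, because \<open>\<alpha>\<close> does.
  \<^item> The space \<open>V\<close> is spanned by \<open>V\<degree>\<close> together with the restrictions of \<open>\<alpha>\<close>: subtracting suitable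
    multiples of them from \<open>v \<in> V\<close> makes the sum over every fibre vanish. Consequently a vector
    \<open>w \<in> W\<close> with \<open>w F = 0\<close> is orthogonal to the whole of \<open>V\<close> (\<open>pairing_dual_kernel_eq_0\<close>).

  The last condition of weak lumping for the reversed chain now holds because, for such a \<open>w\<close>, the
  \<open>b\<close>-th entry of \<open>w P\<^sup>\<star> F\<close> is the product of \<open>w\<close> with the image under \<open>P\<close> of the restriction of \<open>\<alpha>\<close>
  to the fibre over \<open>b\<close>, which is again an element of \<open>V\<close>.

  The real and the complex case differ only in the conjugation. Both the identity on the
  reals and the complex conjugation are ring homomorphisms that fix the reals, and the argument is
  carried out once for an arbitrary map of this kind.
\<close>

section \<open>Row vectors, fibre projections and fibre sums\<close>

lemma vec_mult_lumping_matrix: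
  fixes v :: "'k::real_field^'a::finite"
  shows "(v v* (lumping_matrix f :: 'k^'b^'a)) $ b = (\<Sum>x\<in>UNIV. if f x = b then v $ x else 0)"
  unfolding vector_matrix_mult_def lumping_matrix_def
  by (auto intro!: sum.cong)

lemma vec_mult_fibre_projection:
  fixes v :: "'k::real_field^'a::finite"
  shows "(v v* fibre_projection f b) $ x = (if f x = b then v $ x else 0)"
proof -
  have "(v v* fibre_projection f b) $ x = (\<Sum>y\<in>UNIV. if y = x then (if f x = b then v $ x else 0) else 0)"
    unfolding vector_matrix_mult_def fibre_projection_def vec_lambda_beta by (rule sum.cong) auto
  then show ?thesis by simp
qed

lemma fibre_projection_lumping:
  fixes v :: "'k::real_field^'a::finite"
  shows "(v v* fibre_projection f b v* (lumping_matrix f :: 'k^'b^'a)) $ d =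
    (if d = b then (v v* (lumping_matrix f :: 'k^'b^'a)) $ b else 0)"
  unfolding vec_mult_lumping_matrix vec_mult_fibre_projection
  by (auto intro!: sum.cong sum.neutral)

lemma sum_vector_matrix_mult:
  fixes A :: "'k::real_field^'n^'m::finite"
  shows "(\<Sum>b\<in>S. g b) v* A = (\<Sum>b\<in>S. g b v* A)"
  by (induction S rule: infinite_finite_induct) (simp_all add: vector_matrix_left_distrib)

lemma sum_eq_0_if_lumping_eq_0:
  fixes v :: "'k::real_field^'a::finite" and f :: "'a \<Rightarrow> 'b::finite"
  assumes "v v* (lumping_matrix f :: 'k^'b^'a) = 0"
  shows "(\<Sum>x\<in>UNIV. v $ x) = 0"
proof -
  have "(\<Sum>x\<in>UNIV. v $ x) = (\<Sum>x\<in>UNIV. \<Sum>b\<in>UNIV. if f x = b then v $ x else 0)"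
    by simp
  also have "\<dots> = (\<Sum>b\<in>UNIV. (v v* (lumping_matrix f :: 'k^'b^'a)) $ b)"
    unfolding vec_mult_lumping_matrix by (rule sum.swap)
  finally show ?thesis using assms by simp
qed

lemma stochastic_time_reversal:
  assumes "stochastic_matrix P" and "stationary_distribution \<alpha> P"
    and pos: "\<And>x. \<alpha> $ x > 0"
  shows "stochastic_matrix (time_reversal \<alpha> P)"
proof -
  have nonneg: "0 \<le> P $ y $ x" for x y
    using assms(1) by (simp add: stochastic_matrix_def prob_vector_def)
  have row_sum: "(\<Sum>y\<in>UNIV. \<alpha> $ y / \<alpha> $ x * P $ y $ x) = 1" for x
  proof -
    have "(\<alpha> v* P) $ x = \<alpha> $ x"
      using assms(2) by (simp add: stationary_distribution_def)
    then have "(\<Sum>y\<in>UNIV. \<alpha> $ y * P $ y $ x) = \<alpha> $ x"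
      by (simp add: vector_matrix_mult_def mult.commute)
    then have "(\<Sum>y\<in>UNIV. \<alpha> $ y * P $ y $ x) / \<alpha> $ x = 1"
      using pos[of x] by simp
    then show ?thesis by (simp add: sum_divide_distrib)
  qed
  show ?thesis
    unfolding stochastic_matrix_def prob_vector_def time_reversal_def
    using row_sum nonneg pos by (simp add: less_imp_le)
qed

section \<open>The weighted inner product\<close>

text \<open>The common structure of the identity on the reals and the complex conjugation.\<close>

locale conjugation =
  fixes c :: "'k::real_field \<Rightarrow> 'k"
  assumes add: "c (x + y) = c x + c y"
    and mult: "c (x * y) = c x * c y"
    and of_real: "c (of_real r) = of_real r"
begin

lemma zero: "c 0 = 0"
  using of_real[of 0] by simp

lemma sum: "c (\<Sum>x\<in>S. g x) = (\<Sum>x\<in>S. c (g x))"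
  by (induction S rule: infinite_finite_induct) (simp_all add: zero add)

definition pairing :: "real^'a \<Rightarrow> 'k^'a \<Rightarrow> 'k^'a::finite \<Rightarrow> 'k" where
  "pairing \<alpha> v w = (\<Sum>x\<in>UNIV. c (v $ x) * w $ x / of_real (\<alpha> $ x))"

definition dual_space :: "('a::finite \<Rightarrow> 'b::finite) \<Rightarrow> real^'a \<Rightarrow> ('k^'a) set \<Rightarrow> ('k^'a) set" where
  "dual_space f \<alpha> V = {w. \<forall>v\<in>lumping_kernel f V. pairing \<alpha> v w = 0}"

lemma pairing_add_left: "pairing \<alpha> (u + v) w = pairing \<alpha> u w + pairing \<alpha> v w"
  by (simp add: pairing_def add distrib_right add_divide_distrib sum.distrib)

lemma pairing_scale_left: "pairing \<alpha> (k *s v) w = c k * pairing \<alpha> v w"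
  by (simp add: pairing_def mult sum_distrib_left mult.assoc)

lemma pairing_sum_left: "pairing \<alpha> (\<Sum>b\<in>S. g b) w = (\<Sum>b\<in>S. pairing \<alpha> (g b) w)"
proof (induction S rule: infinite_finite_induct)
  case (insert b S)
  then show ?case by (simp add: pairing_add_left)
qed (simp_all add: pairing_def zero)

lemma subspace_dual_space: "vec.subspace (dual_space f \<alpha> V)"
proof -
  have "pairing \<alpha> v (u + w) = pairing \<alpha> v u + pairing \<alpha> v w" for v u w
    by (simp add: pairing_def distrib_left add_divide_distrib sum.distrib)
  moreover have "pairing \<alpha> v (k *s w) = k * pairing \<alpha> v w" for v w k
    by (simp add: pairing_def sum_distrib_left mult.left_commute)
  moreover have "pairing \<alpha> v 0 = 0" for v
    by (simp add: pairing_def)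
  ultimately show ?thesis
    unfolding vec.subspace_def dual_space_def by simp
qed

text \<open>
  In \<open>P\<^sup>\<star>(y, x)/\<alpha>(x) = P(x, y)/\<alpha>(y)\<close> the weight moves from \<open>x\<close> to \<open>y\<close>; the entries of \<open>P\<close> are real, so
  the conjugation leaves them alone.
\<close>

lemma pairing_time_reversal:
  assumes pos: "\<And>x. \<alpha> $ x > 0"
  shows "pairing \<alpha> v (w v* map_matrix of_real (time_reversal \<alpha> P)) =
    pairing \<alpha> (v v* map_matrix of_real P) w"
proof -
  have nz: "\<alpha> $ x \<noteq> 0" for x
    using pos[of x] by simp
  have "pairing \<alpha> v (w v* map_matrix of_real (time_reversal \<alpha> P)) =
      (\<Sum>x\<in>UNIV. \<Sum>y\<in>UNIV. c (v $ x) * of_real (P $ x $ y) * w $ y / of_real (\<alpha> $ y))"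
    unfolding pairing_def vector_matrix_mult_def map_matrix_def time_reversal_def
    by (auto simp: sum_distrib_left sum_divide_distrib nz field_simps intro!: sum.cong)
  also have "\<dots> = (\<Sum>y\<in>UNIV. \<Sum>x\<in>UNIV. c (v $ x) * of_real (P $ x $ y) * w $ y / of_real (\<alpha> $ y))"
    by (rule sum.swap)
  also have "\<dots> = pairing \<alpha> (v v* map_matrix of_real P) w"
    unfolding pairing_def vector_matrix_mult_def map_matrix_def
    by (auto simp: sum mult of_real sum_distrib_left sum_distrib_right sum_divide_distrib mult_ac
        intro!: sum.cong)
  finally show ?thesis .
qed

lemma pairing_fibre_projection:
  "pairing \<alpha> v (w v* fibre_projection f b) = pairing \<alpha> (v v* fibre_projection f b) w"
  unfolding pairing_def vec_mult_fibre_projection by (auto intro!: sum.cong simp: zero)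

text \<open>The weights \<open>1/\<alpha>\<close> cancel the entries of \<open>\<alpha>\<close>, which leaves the plain sum over the fibre.\<close>

lemma pairing_fibre_restriction:
  fixes f :: "'a::finite \<Rightarrow> 'b::finite"
  assumes pos: "\<And>x. \<alpha> $ x > 0"
  shows "pairing \<alpha> (of_real_vec \<alpha> v* fibre_projection f b) w =
    (w v* (lumping_matrix f :: 'k^'b^'a)) $ b"
proof -
  have nz: "(of_real (\<alpha> $ x) :: 'k) \<noteq> 0" for x
    using pos[of x] by simp
  show ?thesis
    unfolding pairing_def vec_mult_fibre_projection vec_mult_lumping_matrix of_real_vec_def
    using nz by (auto simp: of_real zero intro!: sum.cong)
qed

section \<open>Weak lumping of the reversed chain\<close>

text \<open>Orthogonality of \<open>\<alpha>\<close> to \<open>V\<degree>\<close>: the weighted product with \<open>\<alpha>\<close> is the (conjugated) total sum.\<close>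

lemma distribution_in_dual_space:
  fixes f :: "'a::finite \<Rightarrow> 'b::finite"
  assumes pos: "\<And>x. \<alpha> $ x > 0"
  shows "of_real_vec \<alpha> \<in> dual_space f \<alpha> V"
proof -
  have nz: "(of_real (\<alpha> $ x) :: 'k) \<noteq> 0" for x
    using pos[of x] by simp
  have "pairing \<alpha> v (of_real_vec \<alpha>) = c (\<Sum>x\<in>UNIV. v $ x)" for v
    unfolding pairing_def of_real_vec_def using nz by (simp add: sum)
  then show ?thesis
    by (auto simp: dual_space_def lumping_kernel_def zero dest!: sum_eq_0_if_lumping_eq_0)
qed

text \<open>
  Both \<open>V\<degree>\<close> and the restrictions of \<open>\<alpha>\<close> to the fibres are orthogonal to \<open>w\<close>, and together they
  span \<open>V\<close>.
\<close>

lemma pairing_dual_kernel_eq_0: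
  fixes f :: "'a::finite \<Rightarrow> 'b::finite"
  assumes "surj f" and pos: "\<And>x. \<alpha> $ x > 0"
    and V: "vec.subspace V" and "of_real_vec \<alpha> \<in> V"
    and proj: "\<And>b v. v \<in> V \<Longrightarrow> v v* fibre_projection f b \<in> V"
    and w: "w \<in> lumping_kernel f (dual_space f \<alpha> V)" and "u \<in> V"
  shows "pairing \<alpha> u w = 0"
proof -
  let ?F = "lumping_matrix f :: 'k^'b^'a"
  define m where "m b = (of_real_vec \<alpha> v* ?F) $ b" for b
  define r where "r b = (of_real_vec \<alpha> :: 'k^'a) v* fibre_projection f b" for b
  define s where "s = (\<Sum>b\<in>UNIV. ((u v* ?F) $ b / m b) *s r b)"
  \<comment> \<open>Surjectivity enters here: the mass that \<open>\<alpha>\<close> gives to a nonempty fibre is nonzero.\<close>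
  have m_nz: "m b \<noteq> 0" for b
  proof -
    obtain a where a: "f a = b" using \<open>surj f\<close> by (metis surjD)
    have "m b = of_real (\<Sum>x\<in>UNIV. if f x = b then \<alpha> $ x else 0)"
      unfolding m_def vec_mult_lumping_matrix of_real_vec_def
      by (auto simp: of_real_sum intro!: sum.cong)
    moreover have "(\<Sum>x\<in>UNIV. if f x = b then \<alpha> $ x else 0) > 0"
      using a pos by (intro sum_pos2[of _ a]) (auto simp: less_imp_le)
    ultimately show ?thesis by (simp del: of_real_sum)
  qed
  have rF: "(r b v* ?F) $ d = (if d = b then m b else 0)" for b d
    unfolding r_def m_def by (rule fibre_projection_lumping)
  have sF: "s v* ?F = u v* ?F"
  proof (rule vec_eq_iff[THEN iffD2, rule_format])
    fix d
    have "(s v* ?F) $ d = (\<Sum>b\<in>UNIV. ((u v* ?F) $ b / m b) * (r b v* ?F) $ d)"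
      unfolding s_def by (simp add: sum_vector_matrix_mult scalar_vector_matrix_assoc)
    also have "\<dots> = (\<Sum>b\<in>UNIV. if b = d then (u v* ?F) $ d else 0)"
      using m_nz by (intro sum.cong) (auto simp: rF)
    finally show "(s v* ?F) $ d = (u v* ?F) $ d" by simp
  qed
  have "s \<in> V"
    unfolding s_def r_def
    using assms by (intro vec.subspace_sum vec.subspace_scale) auto
  then have "u - s \<in> lumping_kernel f V"
    using sF V \<open>u \<in> V\<close> by (simp add: lumping_kernel_def vec.subspace_diff vector_matrix_mult_diff_distrib)
  then have "pairing \<alpha> (u - s) w = 0"
    using w by (simp add: lumping_kernel_def dual_space_def)
  moreover have "pairing \<alpha> (r b) w = 0" for b
    unfolding r_def pairing_fibre_restriction[OF pos] using w by (simp add: lumping_kernel_def)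
  then have "pairing \<alpha> s w = 0"
    by (simp add: s_def pairing_sum_left pairing_scale_left)
  ultimately show ?thesis
    using pairing_add_left[of \<alpha> "u - s" s w] by simp
qed

lemma time_reversal_lumps_weakly:
  fixes f :: "'a::finite \<Rightarrow> 'b::finite" and V :: "('k^'a) set"
  assumes "surj f" and "stationary_distribution \<alpha> P" and pos: "\<And>x. \<alpha> $ x > 0"
    and lumps: "lumps_weakly f P V" and "of_real_vec \<alpha> \<in> V"
  shows "lumps_weakly f (time_reversal \<alpha> P) (dual_space f \<alpha> V)"
proof -
  let ?F = "lumping_matrix f :: 'k^'b^'a"
  let ?P = "map_matrix of_real P :: 'k^'a^'a"
  let ?R = "map_matrix of_real (time_reversal \<alpha> P) :: 'k^'a^'a"
  have V: "stochastic_matrix P" "vec.subspace V" "\<And>v. v \<in> V \<Longrightarrow> v v* ?P \<in> V"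
    "\<And>b v. v \<in> V \<Longrightarrow> v v* fibre_projection f b \<in> V"
    "\<And>v. v \<in> lumping_kernel f V \<Longrightarrow> v v* ?P v* ?F = 0"
    using lumps unfolding lumps_weakly_def by blast+
  have kernel_P: "v v* ?P \<in> lumping_kernel f V" if "v \<in> lumping_kernel f V" for v
    using V(3,5) that by (simp add: lumping_kernel_def)
  have kernel_proj: "v v* fibre_projection f b \<in> lumping_kernel f V"
    if "v \<in> lumping_kernel f V" for v b
    using V(4) that by (simp add: lumping_kernel_def vec_eq_iff fibre_projection_lumping)
  \<comment> \<open>Read off each entry as a product and move the reversal to the other side as \<open>P\<close>.\<close>
  have "w v* ?R v* ?F = 0" if w: "w \<in> lumping_kernel f (dual_space f \<alpha> V)" for w
  proof (rule vec_eq_iff[THEN iffD2, rule_format])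
    fix b
    have "(w v* ?R v* ?F) $ b = pairing \<alpha> (of_real_vec \<alpha> v* fibre_projection f b v* ?P) w"
      unfolding pairing_time_reversal[OF pos, symmetric] pairing_fibre_restriction[OF pos] ..
    also have "\<dots> = 0"
      using assms V w by (intro pairing_dual_kernel_eq_0[of f \<alpha> V]) auto
    finally show "(w v* ?R v* ?F) $ b = 0 $ b" by simp
  qed
  moreover have "\<forall>w\<in>dual_space f \<alpha> V. w v* ?R \<in> dual_space f \<alpha> V"
    using kernel_P by (simp add: dual_space_def pairing_time_reversal[OF pos])
  moreover have "\<forall>b. \<forall>w\<in>dual_space f \<alpha> V. w v* fibre_projection f b \<in> dual_space f \<alpha> V"
    using kernel_proj by (simp add: dual_space_def pairing_fibre_projection)
  moreover have "\<exists>p. prob_vector p \<and> of_real_vec p \<in> dual_space f \<alpha> V"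
    using assms(2) distribution_in_dual_space[OF pos]
    unfolding stationary_distribution_def by blast
  ultimately show ?thesis
    using stochastic_time_reversal[OF V(1) assms(2) pos] subspace_dual_space
    unfolding lumps_weakly_def by blast
qed

end

theorem theorem10p1:
  fixes f :: "'a::finite \<Rightarrow> 'b::finite"
    and P :: "real^'a^'a"
    and \<alpha> :: "real^'a"
  assumes "surj f"
    and "stochastic_matrix P"
    and "stationary_distribution \<alpha> P"
    and "\<And>x. \<alpha> $ x > 0"
  shows "(\<forall>V :: (real^'a) set. lumps_weakly f P V \<and> \<alpha> \<in> V \<longrightarrow>
            \<alpha> \<in> dual_space_real f \<alpha> V \<and>
            lumps_weakly f (time_reversal \<alpha> P) (dual_space_real f \<alpha> V)) \<and>
         (\<forall>V :: (complex^'a) set. lumps_weakly f P V \<and> of_real_vec \<alpha> \<in> V \<longrightarrow>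
            of_real_vec \<alpha> \<in> dual_space_complex f \<alpha> V \<and>
            lumps_weakly f (time_reversal \<alpha> P) (dual_space_complex f \<alpha> V))"
proof -
  interpret real_case: conjugation "\<lambda>x::real. x"
    by unfold_locales simp_all
  interpret complex_case: conjugation cnj
    by unfold_locales simp_all
  have real_dual: "dual_space_real f \<alpha> V = real_case.dual_space f \<alpha> V" for V
    by (simp add: dual_space_real_def real_case.dual_space_def real_case.pairing_def)
  have complex_dual: "dual_space_complex f \<alpha> V = complex_case.dual_space f \<alpha> V" for V
    by (simp add: dual_space_complex_def complex_case.dual_space_def complex_case.pairing_def)
  have real_vec: "of_real_vec \<alpha> = \<alpha>"
    by (simp add: of_real_vec_def)
  show ?thesis
    unfolding real_dual complex_dual
    using assms real_case.distribution_in_dual_space[of \<alpha> f]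
      complex_case.distribution_in_dual_space[of \<alpha> f]
      real_case.time_reversal_lumps_weakly[of f \<alpha> P]
      complex_case.time_reversal_lumps_weakly[of f \<alpha> P]
    by (simp add: real_vec)
qed

end
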